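(* (Geometric Newton-Gregory forward interpolation formula.) Let $n$ be a positive integer, let $a,h\in\mathbb{C}(G)$ with $h\neq1$, and let $f$ be a $\mathbb{C}(G)$-valued function taking the values $f(a),f(a\oplus h),f(a\oplus e^2\odot h),\dots,f(a\oplus e^n\odot h)$ at the $n+1$ geometrically equidistant points $a,a\oplus h,a\oplus e^2\odot h,\dots,a\oplus e^n\odot h$. Let $$\begin{aligned}P_n(x)=\;&A_0\oplus A_1\odot(x\ominus a)\oplus A_2\odot(x\ominus a)\odot(x\ominus a\ominus h)\oplus\cdots\\&\oplus A_n\odot(x\ominus a)\odot(x\ominus a\ominus h)\odot\cdots\odot(x\ominus a\ominus e^{n-1}\odot h)\end{aligned}$$ be the geometric polynomial whose coefficients $A_0,\dots,A_n\in\mathbb{C}(G)$ are chosen so that $P_n(a\oplus e^k\odot h)=f(a\oplus e^k\odot h)$ for $k=0,1,\dots,n$. Then $$\begin{aligned}P_n(x)=\;&f(a)\oplus\bigl(\Delta_G f(a)\oslash h\bigr)\odot(x\ominus a)\oplus\bigl(\Delta_G^2f(a)\oslash(2!_G\odot h^{2_G})\bigr)\odot(x\ominus a)\odot(x\ominus a\ominus h)\oplus\cdots\\&\oplus\bigl(\Delta_G^nf(a)\oslash(n!_G\odot h^{n_G})\bigr)\odot(x\ominus a)\odot(x\ominus a\ominus h)\odot\cdots\odot(x\ominus a\ominus e^{n-1}\odot h).\end{aligned}$$ Equivalently, writing $u=(x\ominus a)\oslash h$, i.e. $x=a\oplus h\odot u$, $$\begin{aligned}P_n(x)=\;&f(a)\oplus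 u\odot\Delta_Gf(a)\oplus\bigl((u\odot(u\ominus e))\oslash 2!_G\bigr)\odot\Delta_G^2f(a)\oplus\cdots\\&\oplus\bigl((u\odot(u\ominus e)\odot\cdots\odot(u\ominus e^{n-1}))\oslash n!_G\bigr)\odot\Delta_G^nf(a).\end{aligned}$$
   Context: Geometric complex numbers: $\mathbb{C}(G)=\{e^z: z\in\mathbb{C}\}$, where the generator $z\mapsto e^z$ is treated as a bijection from $\mathbb{C}$ onto $\mathbb{C}(G)$ with inverse $\ln$ (so an element of $\mathbb{C}(G)$ determines its exponent $z$). Operations: $e^z\oplus e^w=e^{z+w}$, $e^z\ominus e^w=e^{z-w}$, $e^z\odot e^w=e^{zw}$, and $e^z\oslash e^w=e^{z/w}$ for $w\ne0$. $(\mathbb{C}(G),\oplus,\odot)$ is a field with geometric zero $1=e^0$ and geometric identity $e=e^1$. $\odot$ binds more tightly than $\oplus,\ominus$. $h^{k_G}=h\odot\cdots\odot h$ ($k$ factors). Geometric factorial: $k!_G=e^{k!}$. Geometric forward differences with step $h$: $\Delta_Gf(x)=f(x\oplus h)\ominus f(x)$ and $\Delta_G^{k}f(x)=\Delta_G^{k-1}f(x\oplus h)\ominus\Delta_G^{k-1}f(x)$ for $k\ge2$. *)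

theory Defs
  imports Complex_Main
begin

(* The number e^z of C(G) is represented as gexp z.  A fresh copy of the complex numbers
   is used instead of the set of nonzero complex numbers because elements of C(G) determine
   their exponent, whereas the complex exponential is not injective. *)
datatype gcomplex = gexp (gln: complex)

lemma gcomplex_eq_iff: "x = y \<longleftrightarrow> gln x = gln y"
  by (auto intro: gcomplex.expand)

(* The class operations +, -, *, / on gcomplex are the geometric ones.  In particular
   0 :: gcomplex is the geometric zero, written 1 = e^0 informally, and 1 :: gcomplex is the
   geometric identity e = e^1.  Hence the class operations sum, prod and (^) are
   the geometric sum, product and power. *)
instantiation gcomplex :: field
begin

definition zero_gcomplex :: gcomplex where "0 = gexp 0"
definition one_gcomplex :: gcomplex where "1 = gexp 1"
definition plus_gcomplex :: "gcomplex \<Rightarrow> gcomplex \<Rightarrow> gcomplex" where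
  "x + y = gexp (gln x + gln y)"
definition minus_gcomplex :: "gcomplex \<Rightarrow> gcomplex \<Rightarrow> gcomplex" where
  "x - y = gexp (gln x - gln y)"
definition uminus_gcomplex :: "gcomplex \<Rightarrow> gcomplex" where
  "- x = gexp (- gln x)"
definition times_gcomplex :: "gcomplex \<Rightarrow> gcomplex \<Rightarrow> gcomplex" where
  "x * y = gexp (gln x * gln y)"
definition inverse_gcomplex :: "gcomplex \<Rightarrow> gcomplex" where
  "inverse x = gexp (inverse (gln x))"
definition divide_gcomplex :: "gcomplex \<Rightarrow> gcomplex \<Rightarrow> gcomplex" where
  "x div y = gexp (gln x / gln y)"

instance
  by standard
    (auto simp: zero_gcomplex_def one_gcomplex_def plus_gcomplex_def minus_gcomplex_def
      uminus_gcomplex_def times_gcomplex_def inverse_gcomplex_def divide_gcomplex_def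
      gcomplex_eq_iff algebra_simps divide_inverse)

end

definition gfact :: "nat \<Rightarrow> gcomplex" where
  "gfact k = gexp (fact k)"

primrec gdiff :: "gcomplex \<Rightarrow> nat \<Rightarrow> (gcomplex \<Rightarrow> gcomplex) \<Rightarrow> gcomplex \<Rightarrow> gcomplex" where
  "gdiff h 0 f x = f x"
| "gdiff h (Suc k) f x = gdiff h k f (x + h) - gdiff h k f x"

(* The factor for j = 0 is x - a, since gexp 0 * h is the geometric zero. *)
definition newton_basis :: "gcomplex \<Rightarrow> gcomplex \<Rightarrow> nat \<Rightarrow> gcomplex \<Rightarrow> gcomplex" where
  "newton_basis a h k x = (\<Prod>j<k. x - a - gexp (of_nat j) * h)"

definition newton_poly ::
  "(nat \<Rightarrow> gcomplex) \<Rightarrow> gcomplex \<Rightarrow> gcomplex \<Rightarrow> nat \<Rightarrow> gcomplex \<Rightarrow> gcomplex" where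
  "newton_poly A a h n x = A 0 + (\<Sum>k=1..n. A k * newton_basis a h k x)"

end

theory Submission
  imports Defs
begin

text \<open>The Newton basis is triangular at the nodes with nonzero diagonal, so interpolation there
  determines the coefficients. The divided differences are coefficients of an interpolant because
  \<open>E\<^sup>m = (1 + \<Delta>)\<^sup>m\<close> for the shift \<open>E\<close> by \<open>h\<close>, expanded binomially.\<close>

lemma gln_simps [simp]:
  "gln 0 = 0" "gln 1 = 1" "gln (x + y) = gln x + gln y"
  by (simp_all add: zero_gcomplex_def one_gcomplex_def plus_gcomplex_def)

lemma gln_of_nat [simp]: "gln (of_nat m) = of_nat m"
  by (induction m) simp_all

lemma gexp_of_nat: "gexp (of_nat m) = of_nat m"
  by (simp add: gcomplex_eq_iff)

text \<open>Characteristic zero makes every \<open>fact k\<close> invertible and gives access to the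
  theory of \<open>gbinomial\<close>.\<close>

instance gcomplex :: field_char_0
  by standard (metis gln_of_nat injI of_nat_eq_iff)

lemma gfact_eq_fact: "gfact k = fact k"
  using gexp_of_nat[of "fact k"] by (simp add: gfact_def)

text \<open>Each of the \<open>k\<close> factors contributes one \<open>h\<close>. This serves both
  the values at the nodes and the form of the formula in \<open>u\<close>.\<close>

lemma newton_basis_affine:
  "newton_basis a h k (a + h * u) = h ^ k * (\<Prod>j<k. u - of_nat j)"
proof -
  have "a + h * u - a - gexp (of_nat j) * h = h * (u - of_nat j)" for j
    by (simp add: gexp_of_nat algebra_simps)
  then show ?thesis
    by (simp add: newton_basis_def prod.distrib)
qed

text \<open>The falling factorial of \<open>m\<close> is \<open>fact k\<close> times a binomial
  coefficient. That coefficient vanishes for \<open>k > m\<close> and is 1 for \<open>k = m\<close>,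
  which is the triangularity.\<close>

lemma newton_basis_node:
  "newton_basis a h k (a + of_nat m * h) = h ^ k * fact k * of_nat (m choose k)"
proof -
  have "(\<Prod>j<k. (of_nat m :: gcomplex) - of_nat j) = fact k * of_nat (m choose k)"
    by (simp add: binomial_gbinomial gbinomial_prod_rev atLeast0LessThan)
  then show ?thesis
    using newton_basis_affine[of a h k "of_nat m"] by (simp add: mult.commute mult.assoc)
qed

lemma newton_poly_eq_sum: "newton_poly A a h n x = (\<Sum>k\<le>n. A k * newton_basis a h k x)"
proof -
  have "{..n} = insert 0 {1..n}" by auto
  then show ?thesis by (simp add: newton_poly_def newton_basis_def)
qed

lemma newton_poly_node:
  assumes "m \<le> n"
  shows "newton_poly A a h n (a + of_nat m * h) = newton_poly A a h m (a + of_nat m * h)"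
  unfolding newton_poly_eq_sum newton_basis_node
  using assms by (intro sum.mono_neutral_right) auto

text \<open>Forward substitution: at node \<open>m\<close> the terms below \<open>m\<close> agree by
  induction, those above vanish, and the diagonal entry \<open>h ^ m * fact m\<close>
  cancels.\<close>

lemma newton_coeffs_unique:
  assumes "h \<noteq> 0"
    and eq: "\<And>k. k \<le> n \<Longrightarrow>
      newton_poly A a h n (a + of_nat k * h) = newton_poly B a h n (a + of_nat k * h)"
  shows "k \<le> n \<Longrightarrow> A k = B k"
proof (induction k rule: less_induct)
  case (less m)
  let ?x = "a + of_nat m * h"
  have "(\<Sum>k<m. A k * newton_basis a h k ?x) = (\<Sum>k<m. B k * newton_basis a h k ?x)"
    using less by (intro sum.cong) auto
  moreover have "newton_poly A a h m ?x = newton_poly B a h m ?x"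
    using eq[OF less.prems] newton_poly_node[OF less.prems] by simp
  ultimately have "A m * newton_basis a h m ?x = B m * newton_basis a h m ?x"
    by (simp add: newton_poly_eq_sum flip: lessThan_Suc_atMost)
  then show ?case
    using \<open>h \<noteq> 0\<close> by (simp add: newton_basis_node)
qed

text \<open>The order \<open>i\<close> is kept general because the induction step needs the
  hypothesis for both \<open>i\<close> and \<open>Suc i\<close>.\<close>

lemma gdiff_shift:
  "gdiff h i f (a + of_nat m * h) = (\<Sum>k\<le>m. of_nat (m choose k) * gdiff h (i + k) f a)"
proof (induction m arbitrary: i)
  case 0
  then show ?case by simp
next
  case (Suc m)
  let ?D = "\<lambda>k. gdiff h (i + k) f a"
  have "gdiff h i f (a + of_nat (Suc m) * h)
      = gdiff h i f (a + of_nat m * h) + gdiff h (Suc i) f (a + of_nat m * h)"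
    by (simp add: algebra_simps)
  also have "\<dots> = (\<Sum>k\<le>m. of_nat (m choose k) * ?D k) + (\<Sum>k\<le>m. of_nat (m choose k) * ?D (Suc k))"
    unfolding Suc.IH by simp
  \<comment> \<open>The added term is zero since \<open>m choose Suc m = 0\<close>; splitting off
    \<open>k = 0\<close> then aligns the two sums.\<close>
  also have "(\<Sum>k\<le>m. of_nat (m choose k) * ?D k) = (\<Sum>k\<le>Suc m. of_nat (m choose k) * ?D k)"
    by simp
  also have "\<dots> = ?D 0 + (\<Sum>k\<le>m. of_nat (m choose Suc k) * ?D (Suc k))"
    by (subst sum.atMost_Suc_shift) simp
  \<comment> \<open>Pascal's rule, with the differences kept folded.\<close>
  also have "\<dots> + (\<Sum>k\<le>m. of_nat (m choose k) * ?D (Suc k))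
      = ?D 0 + (\<Sum>k\<le>m. of_nat (Suc m choose Suc k) * ?D (Suc k))"
    by (simp add: sum.distrib distrib_right add_ac del: gdiff.simps)
  also have "\<dots> = (\<Sum>k\<le>Suc m. of_nat (Suc m choose k) * ?D k)"
    by (subst sum.atMost_Suc_shift) simp
  finally show ?case .
qed

text \<open>At a node the denominator cancels the factor \<open>h ^ k * fact k\<close> of the basis,
  leaving the case \<open>i = 0\<close> of \<open>gdiff_shift\<close>.\<close>

lemma newton_poly_gdiff_interpolates:
  assumes "h \<noteq> 0" and "m \<le> n"
  shows "newton_poly (\<lambda>k. gdiff h k f a / (gfact k * h ^ k)) a h n (a + of_nat m * h)
    = f (a + of_nat m * h)"
proof -
  have "newton_poly (\<lambda>k. gdiff h k f a / (gfact k * h ^ k)) a h m (a + of_nat m * h)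
    = (\<Sum>k\<le>m. of_nat (m choose k) * gdiff h (0 + k) f a)"
    unfolding newton_poly_eq_sum newton_basis_node gfact_eq_fact
    using assms(1) by (intro sum.cong) (auto simp: field_simps)
  then show ?thesis
    by (simp only: newton_poly_node[OF assms(2)] gdiff.simps flip: gdiff_shift)
qed

theorem mainTheorem4:
  fixes n :: nat and a h :: gcomplex
    and f :: "gcomplex \<Rightarrow> gcomplex" and A :: "nat \<Rightarrow> gcomplex"
  assumes "n > 0"
    and "h \<noteq> gexp 0"
    and "\<And>k. k \<le> n \<Longrightarrow>
      newton_poly A a h n (a + gexp (of_nat k) * h) = f (a + gexp (of_nat k) * h)"
  shows "(\<forall>x. newton_poly A a h n x =
            f a + (\<Sum>k=1..n. (gdiff h k f a / (gfact k * h ^ k)) * newton_basis a h k x)) \<and>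
         (\<forall>x u. u = (x - a) / h \<longrightarrow>
            x = a + h * u \<and>
            newton_poly A a h n x =
              f a + (\<Sum>k=1..n. ((\<Prod>j<k. u - gexp (of_nat j)) / gfact k) * gdiff h k f a))"
proof -
  define B where "B k = gdiff h k f a / (gfact k * h ^ k)" for k
  have h: "h \<noteq> 0"
    using assms(2) by (simp add: zero_gcomplex_def)
  have "A k = B k" if "k \<le> n" for k
    using that
  proof (rule newton_coeffs_unique[OF h, rotated])
    fix k assume "k \<le> n"
    then show "newton_poly A a h n (a + of_nat k * h) = newton_poly B a h n (a + of_nat k * h)"
      using assms(3)[of k] newton_poly_gdiff_interpolates[OF h, of k n f a]
      by (simp add: gexp_of_nat B_def[abs_def])
  qed
  then have "newton_poly A a h n x = newton_poly B a h n x" for x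
    by (simp add: newton_poly_eq_sum)
  \<comment> \<open>The constant term is \<open>B 0 = f a\<close>, as its denominator is 1.\<close>
  then have *: "newton_poly A a h n x = f a + (\<Sum>k=1..n. B k * newton_basis a h k x)" for x
    by (simp add: newton_poly_def B_def gfact_eq_fact)
  \<comment> \<open>The factor \<open>h ^ k\<close> of the basis cancels against the one in
    \<open>B k\<close>.\<close>
  have "newton_poly A a h n (a + h * u) =
      f a + (\<Sum>k=1..n. ((\<Prod>j<k. u - gexp (of_nat j)) / gfact k) * gdiff h k f a)" for u
    unfolding * newton_basis_affine B_def
    using h by (simp add: gexp_of_nat mult.commute)
  moreover have "x = a + h * ((x - a) / h)" for x
    using h by simp
  ultimately show ?thesis
    using * unfolding B_def by metis
qed

end
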